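(* For any Cauchy sequence of rational numbers $\{x^{(n)}\}_{n\in\mathbb N}$, we have $$\underline{\mathrm{LIMIT}}(\{x^{(n)}\}_{n\in\mathbb N})\sim\overline{\mathrm{LIMIT}}(\{x^{(n)}\}_{n\in\mathbb N}).$$
   Context: $\mathbb N=\{1,2,3,\dots\}$ and $\mathcal Z_{10}=\{0,1,\dots,9\}$. $\mathcal R$ is the set of all formal decimals $x=x_0.x_1x_2x_3\cdots$ with $x_0\in\mathbb Z$ and $x_k\in\mathcal Z_{10}$ for $k\in\mathbb N$; two elements are equal iff all their digits agree. For $k\in\mathbb N$, $[x]_k=\sum_{i=0}^k x_i10^{-i}\in\mathbb Q$. Order on $\mathcal R$: $x\preceq y$ iff $[x]_k\le [y]_k$ for all $k\in\mathbb N$. Every nonempty bounded above (below) subset of $(\mathcal R,\preceq)$ has a supremum (infimum). $x\sim y$ ("no gap") means that there is no $z\in\mathcal R\setminus\{x,y\}$ lying strictly between $x$ and $y$ with respect to $\preceq$; $\sim$ is an equivalence relation. $\mathbb Q$ is regarded as a subset of $\mathcal R$ via long division: $\alpha=q/p$ ($p\in\mathbb N$, $q\in\mathbb Z$) is identified with $\alpha_0.\alpha_1\alpha_2\cdots$, where $\alpha_0=\lfloor q/p\rfloor$, $\beta_0=q-\alpha_0p$, $\alpha_{k+1}=\lfloor 10\beta_k/p\rfloor$, $\beta_{k+1}=10\beta_k-\alpha_{k+1}p$. For a bounded sequence $\{x^{(n)}\}_{n\in\mathbb N}$ in $\mathcal R$: $\overline{\mathrm{LIMIT}}(\{x^{(n)}\})=\inf\{\sup\{x^{(k)}: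 k\ge n\}: n\in\mathbb N\}$ and $\underline{\mathrm{LIMIT}}(\{x^{(n)}\})=\sup\{\inf\{x^{(k)}: k\ge n\}: n\in\mathbb N\}$, with $\sup$, $\inf$ taken in $(\mathcal R,\preceq)$. A sequence of rational numbers $\{x^{(n)}\}_{n\in\mathbb N}$ is Cauchy if for every rational $\epsilon>0$ there is $N\in\mathbb N$ such that $|x^{(m)}-x^{(n)}|<\epsilon$ for all $m,n\ge N$. *)

theory Defs
  imports Complex_Main
begin

typedef decimal = "{x :: nat \<Rightarrow> int. \<forall>k\<ge>1. x k \<in> {0..9}}"
  morphisms digit Decimal
  by (rule exI[of _ "\<lambda>_. 0"]) simp

setup_lifting type_definition_decimal

lemma digit_bounds: "k \<ge> 1 \<Longrightarrow> 0 \<le> digit x k \<and> digit x k \<le> 9"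
  using digit[of x] by auto

lemma decimal_eq_iff: "x = y \<longleftrightarrow> (\<forall>k. digit x k = digit y k)"
  by (auto simp: digit_inject[symmetric] fun_eq_iff)

definition trunc :: "decimal \<Rightarrow> nat \<Rightarrow> rat" where
  "trunc x k = (\<Sum>i\<le>k. of_int (digit x i) / 10 ^ i)"

definition lex_less :: "decimal \<Rightarrow> decimal \<Rightarrow> bool" where
  "lex_less x y \<longleftrightarrow> (\<exists>i. (\<forall>j<i. digit x j = digit y j) \<and> digit x i < digit y i)"

lemma lex_linear: "x = y \<or> lex_less x y \<or> lex_less y x"
proof (cases "x = y")
  case False
  then have ex: "\<exists>i. digit x i \<noteq> digit y i" by (simp add: decimal_eq_iff)
  define i where "i = (LEAST i. digit x i \<noteq> digit y i)"
  have "digit x i \<noteq> digit y i" unfolding i_def using ex by (rule LeastI_ex)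
  moreover have "\<forall>j<i. digit x j = digit y j"
    unfolding i_def using not_less_Least by blast
  ultimately show ?thesis unfolding lex_less_def by (metis linorder_neqE)
qed simp

lemma trunc_agree:
  assumes "\<forall>j\<le>k. digit x j = digit y j"
  shows "trunc x k = trunc y k"
  unfolding trunc_def using assms by (intro sum.cong) auto

lemma trunc_gap:
  assumes "\<forall>j<i. digit x j = digit y j" "digit x i < digit y i"
  shows "trunc x (i + m) + 1 / 10 ^ (i + m) \<le> trunc y (i + m)"
proof (induction m)
  case 0
  have s: "trunc z i = (\<Sum>j<i. of_int (digit z j) / 10 ^ j) + of_int (digit z i) / 10 ^ i" for z
    unfolding trunc_def by (simp add: lessThan_Suc_atMost[symmetric])
  have e: "(\<Sum>j<i. of_int (digit x j) / 10 ^ j :: rat) = (\<Sum>j<i. of_int (digit y j) / 10 ^ j)"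
    using assms(1) by (intro sum.cong) auto
  have "of_int (digit x i) + 1 \<le> (of_int (digit y i) :: rat)"
    using assms(2) of_int_le_iff[of "digit x i + 1" "digit y i", where 'a = rat] by simp
  then have "(of_int (digit x i) + 1) / 10 ^ i \<le> (of_int (digit y i) :: rat) / 10 ^ i"
    by (intro divide_right_mono) auto
  then show ?case by (simp add: s e add_divide_distrib)
next
  case (Suc m)
  let ?n = "i + m"
  have s: "trunc z (Suc ?n) = trunc z ?n + of_int (digit z (Suc ?n)) / 10 ^ Suc ?n" for z
    unfolding trunc_def by simp
  have "digit x (Suc ?n) + 1 \<le> digit y (Suc ?n) + 10"
    using digit_bounds[of "Suc ?n" x] digit_bounds[of "Suc ?n" y] by simp
  then have "of_int (digit x (Suc ?n)) + 1 \<le> (of_int (digit y (Suc ?n)) + 10 :: rat)"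
    using of_int_le_iff[of "digit x (Suc ?n) + 1" "digit y (Suc ?n) + 10", where 'a = rat] by simp
  then have "(of_int (digit x (Suc ?n)) + 1) / 10 ^ Suc ?n
      \<le> (of_int (digit y (Suc ?n)) + 10 :: rat) / 10 ^ Suc ?n"
    by (intro divide_right_mono) auto
  then show ?case using Suc.IH by (simp add: s add_divide_distrib)
qed

lemma lex_trunc_le:
  assumes "lex_less x y" shows "trunc x k \<le> trunc y k"
proof -
  obtain i where i: "\<forall>j<i. digit x j = digit y j" "digit x i < digit y i"
    using assms unfolding lex_less_def by blast
  show ?thesis
  proof (cases "k < i")
    case True
    then show ?thesis using trunc_agree[of k x y] i(1) by simp
  next
    case False
    then obtain m where k: "k = i + m" using le_Suc_ex not_less by blast
    have "trunc x k \<le> trunc x k + 1 / 10 ^ k" by simp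
    also have "\<dots> \<le> trunc y k" using trunc_gap[OF i, of m] k by simp
    finally show ?thesis .
  qed
qed

lemma lex_not_trunc_le:
  assumes "lex_less x y" shows "\<exists>k\<ge>1. trunc x k < trunc y k"
proof -
  obtain i where i: "\<forall>j<i. digit x j = digit y j" "digit x i < digit y i"
    using assms unfolding lex_less_def by blast
  have "trunc x (i + 1) < trunc x (i + 1) + 1 / 10 ^ (i + 1)" by simp
  also have "\<dots> \<le> trunc y (i + 1)" by (rule trunc_gap[OF i])
  finally have "trunc x (i + 1) < trunc y (i + 1)" .
  then show ?thesis by (intro exI[of _ "i + 1"]) simp
qed

instantiation decimal :: linorder
begin

definition less_eq_decimal :: "decimal \<Rightarrow> decimal \<Rightarrow> bool" where
  "x \<le> y \<longleftrightarrow> (\<forall>k\<ge>1. trunc x k \<le> trunc y k)"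

definition less_decimal :: "decimal \<Rightarrow> decimal \<Rightarrow> bool" where
  "x < y \<longleftrightarrow> x \<le> y \<and> x \<noteq> (y :: decimal)"

instance
proof
  fix x y z :: decimal
  have anti: "a = b" if "a \<le> b" "b \<le> a" for a b :: decimal
    using lex_linear[of a b] lex_not_trunc_le[of a b] lex_not_trunc_le[of b a] that
    unfolding less_eq_decimal_def by (meson not_less)
  show "x < y \<longleftrightarrow> x \<le> y \<and> \<not> y \<le> x"
    unfolding less_decimal_def using anti[of x y] lex_linear[of x y] lex_trunc_le
    by (metis less_eq_decimal_def order.refl)
  show "x \<le> x" by (simp add: less_eq_decimal_def)
  show "x \<le> z" if "x \<le> y" "y \<le> z"
    using that unfolding less_eq_decimal_def by (meson order_trans)
  show "x = y" if "x \<le> y" "y \<le> x" using that by (rule anti)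
  show "x \<le> y \<or> y \<le> x"
    using lex_linear[of x y] lex_trunc_le by (auto simp: less_eq_decimal_def)
qed

end

lemma less_decimal_iff_lex: "x < y \<longleftrightarrow> lex_less x y"
proof
  assume "lex_less x y"
  then have "x \<le> y" "\<not> y \<le> x"
    using lex_trunc_le lex_not_trunc_le[of x y] unfolding less_eq_decimal_def
    by (blast, meson not_less)
  then show "x < y" by simp
next
  assume l: "x < y"
  have "\<not> lex_less y x"
    using l lex_trunc_le[of y x] unfolding less_eq_decimal_def less_decimal_def
    by (metis l leD less_eq_decimal_def)
  then show "lex_less x y" using l lex_linear[of x y] by auto
qed

lemma decimal_lub_exists:
  fixes A :: "decimal set"
  assumes ne: "A \<noteq> {}" and ub: "\<forall>a\<in>A. a \<le> u"
  shows "\<exists>s. (\<forall>a\<in>A. a \<le> s) \<and> (\<forall>v. (\<forall>a\<in>A. a \<le> v) \<longrightarrow> s \<le> v)"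
proof -
  define P where "P = rec_nat A (\<lambda>k B. {x\<in>B. \<forall>y\<in>B. digit y k \<le> digit x k})"
  have P0: "P 0 = A" and PS: "P (Suc k) = {x\<in>P k. \<forall>y\<in>P k. digit y k \<le> digit x k}" for k
    by (simp_all add: P_def)
  have anti: "P (k + m) \<subseteq> P k" for k m by (induction m) (auto simp: PS)
  have bd: "\<exists>b. \<forall>y\<in>P k. digit y k \<le> b" for k
  proof (cases k)
    case 0
    have "digit y 0 \<le> digit u 0" if "y \<in> A" for y
    proof -
      have "y = u \<or> lex_less y u" using ub that less_decimal_iff_lex by (metis order_le_less)
      then show ?thesis unfolding lex_less_def by (metis gr0I order.refl order_less_imp_le)
    qed
    then show ?thesis using 0 P0 by auto
  next
    case (Suc n) then show ?thesis using digit_bounds[of k] by auto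
  qed
  have nonempty: "P k \<noteq> {}" for k
  proof (induction k)
    case 0 then show ?case using ne P0 by simp
  next
    case (Suc k)
    then obtain x where x: "x \<in> P k" by blast
    obtain b where b: "\<forall>y\<in>P k. digit y k \<le> b" using bd by blast
    obtain y where y: "y \<in> P k" "\<forall>z. z \<in> P k \<longrightarrow> nat (b - digit y k) \<le> nat (b - digit z k)"
      using ex_has_least_nat[of "\<lambda>z. z \<in> P k" x "\<lambda>z. nat (b - digit z k)"] x by blast
    have "digit z k \<le> digit y k" if "z \<in> P k" for z
      using y b that by (smt (verit) nat_le_eq_zle)
    then show ?case using y(1) PS by auto
  qed
  define s where "s = Decimal (\<lambda>k. digit (SOME x. x \<in> P (Suc k)) k)"
  have some: "(SOME x. x \<in> P (Suc k)) \<in> P (Suc k)" for k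
    using nonempty by (simp add: some_in_eq)
  have ds: "digit s k = digit (SOME x. x \<in> P (Suc k)) k" for k
    unfolding s_def using digit_bounds by (subst Decimal_inverse) auto
  have eq: "digit x k = digit s k" if "x \<in> P (Suc k)" for x k
  proof -
    have "x \<in> P k" "(SOME x. x \<in> P (Suc k)) \<in> P k" using some[of k] that PS by auto
    then show ?thesis using some[of k] that unfolding ds PS by (metis (mono_tags, lifting) mem_Collect_eq order.antisym)
  qed
  have agree: "\<forall>j<k. digit x j = digit s j" if x: "x \<in> P k" for x k
  proof (intro allI impI)
    fix j assume "j < k"
    then have "x \<in> P (Suc j)" using x anti[of "Suc j" "k - Suc j"] by auto
    then show "digit x j = digit s j" by (rule eq)
  qed
  have mem: "x \<in> P k" if "x \<in> A" "\<forall>j<k. digit x j = digit s j" for x k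
    using that(2)
  proof (induction k)
    case 0 then show ?case using that P0 by simp
  next
    case (Suc k)
    then have xk: "x \<in> P k" by simp
    have "digit y k \<le> digit x k" if "y \<in> P k" for y
      using that some[of k] Suc.prems ds PS by auto
    then show ?case using xk PS by auto
  qed
  have "x \<le> s" if x: "x \<in> A" for x
  proof (rule ccontr)
    assume "\<not> x \<le> s"
    then obtain i where i: "\<forall>j<i. digit s j = digit x j" "digit s i < digit x i"
      using less_decimal_iff_lex lex_less_def by (metis not_le)
    then have "x \<in> P i" using mem x by simp
    then have "digit x i \<le> digit s i" using some[of i] ds PS by auto
    with i show False by simp
  qed
  moreover have "s \<le> v" if v: "\<forall>a\<in>A. a \<le> v" for v
  proof (rule ccontr)
    assume "\<not> s \<le> v"
    then obtain i where i: "\<forall>j<i. digit v j = digit s j" "digit v i < digit s i"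
      using less_decimal_iff_lex lex_less_def by (metis not_le)
    obtain x where x: "x \<in> P (Suc i)" using nonempty by blast
    have "lex_less v x" unfolding lex_less_def
      using i agree[OF x] by (intro exI[of _ i]) auto
    moreover have "x \<in> A" using x anti[of 0 "Suc i"] P0 by auto
    ultimately show False using v less_decimal_iff_lex by (meson leD)
  qed
  ultimately show ?thesis by blast
qed

lemma decimal_glb_exists:
  fixes A :: "decimal set"
  assumes ne: "A \<noteq> {}" and lb: "\<forall>a\<in>A. u \<le> a"
  shows "\<exists>s. (\<forall>a\<in>A. s \<le> a) \<and> (\<forall>v. (\<forall>a\<in>A. v \<le> a) \<longrightarrow> v \<le> s)"
proof -
  obtain a where a: "a \<in> A" using ne by blast
  let ?L = "{v. \<forall>a\<in>A. v \<le> a}"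
  obtain s where "\<forall>v\<in>?L. v \<le> s" "\<forall>w. (\<forall>v\<in>?L. v \<le> w) \<longrightarrow> s \<le> w"
    using decimal_lub_exists[of ?L a] a lb by auto
  then show ?thesis by (intro exI[of _ s]) auto
qed

instantiation decimal :: conditionally_complete_linorder
begin

definition inf_decimal :: "decimal \<Rightarrow> decimal \<Rightarrow> decimal" where
  "inf_decimal = min"

definition sup_decimal :: "decimal \<Rightarrow> decimal \<Rightarrow> decimal" where
  "sup_decimal = max"

definition Sup_decimal :: "decimal set \<Rightarrow> decimal" where
  "Sup A = (LEAST s::decimal. \<forall>a\<in>A. a \<le> s)"

definition Inf_decimal :: "decimal set \<Rightarrow> decimal" where
  "Inf A = (GREATEST s::decimal. \<forall>a\<in>A. s \<le> a)"

instance
proof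
  fix x y z :: decimal and A :: "decimal set"
  show "inf x y \<le> x" "inf x y \<le> y" "x \<le> sup x y" "y \<le> sup x y"
    by (simp_all add: inf_decimal_def sup_decimal_def)
  show "x \<le> inf y z" if "x \<le> y" "x \<le> z" using that by (simp add: inf_decimal_def)
  show "sup y z \<le> x" if "y \<le> x" "z \<le> x" using that by (simp add: sup_decimal_def)
  have sup: "(\<forall>a\<in>A. a \<le> Sup A) \<and> (\<forall>v. (\<forall>a\<in>A. a \<le> v) \<longrightarrow> Sup A \<le> v)"
    if ne: "A \<noteq> {}" and bd: "bdd_above A"
  proof -
    obtain u where "\<forall>a\<in>A. a \<le> u" using bd by (auto simp: bdd_above_def)
    then obtain s where s: "\<forall>a\<in>A. a \<le> s" "\<forall>v. (\<forall>a\<in>A. a \<le> v) \<longrightarrow> s \<le> v"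
      using decimal_lub_exists[OF ne] by blast
    have "Sup A = s" unfolding Sup_decimal_def by (rule Least_equality) (use s in auto)
    with s show ?thesis by simp
  qed
  have inf: "(\<forall>a\<in>A. Inf A \<le> a) \<and> (\<forall>v. (\<forall>a\<in>A. v \<le> a) \<longrightarrow> v \<le> Inf A)"
    if ne: "A \<noteq> {}" and bd: "bdd_below A"
  proof -
    obtain u where "\<forall>a\<in>A. u \<le> a" using bd by (auto simp: bdd_below_def)
    then obtain s where s: "\<forall>a\<in>A. s \<le> a" "\<forall>v. (\<forall>a\<in>A. v \<le> a) \<longrightarrow> v \<le> s"
      using decimal_glb_exists[OF ne] by blast
    have "Inf A = s" unfolding Inf_decimal_def by (rule Greatest_equality) (use s in auto)
    with s show ?thesis by simp
  qed
  show "x \<le> Sup A" if "x \<in> A" "bdd_above A" using sup that by blast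
  show "Sup A \<le> z" if "A \<noteq> {}" "\<And>x. x \<in> A \<Longrightarrow> x \<le> z"
    using sup that by (meson bdd_above.I)
  show "Inf A \<le> x" if "x \<in> A" "bdd_below A" using inf that by blast
  show "z \<le> Inf A" if "A \<noteq> {}" "\<And>x. x \<in> A \<Longrightarrow> z \<le> x"
    using inf that by (meson bdd_below.I)
qed

end

definition no_gap :: "decimal \<Rightarrow> decimal \<Rightarrow> bool" where
  "no_gap x y \<longleftrightarrow> \<not> (\<exists>z. x < z \<and> z < y \<or> y < z \<and> z < x)"

text \<open>Long division of \<open>q\<close> by \<open>p > 0\<close>, with quotient digits and remainders;
  integer \<open>div\<close> rounds down, so it is the floor of the quotient also for negative \<open>q\<close>.\<close>

fun ld_rem :: "int \<Rightarrow> int \<Rightarrow> nat \<Rightarrow> int" where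
  "ld_rem q p 0 = q - (q div p) * p"
| "ld_rem q p (Suc k) = 10 * ld_rem q p k - (10 * ld_rem q p k div p) * p"

fun ld_digit :: "int \<Rightarrow> int \<Rightarrow> nat \<Rightarrow> int" where
  "ld_digit q p 0 = q div p"
| "ld_digit q p (Suc k) = 10 * ld_rem q p k div p"

lemma ld_rem_bounds: "p > 0 \<Longrightarrow> 0 \<le> ld_rem q p k \<and> ld_rem q p k < p"
  by (cases k) (simp_all add: minus_div_mult_eq_mod)

lemma ld_digit_bounds:
  assumes "p > 0" "k \<ge> 1" shows "ld_digit q p k \<in> {0..9}"
proof -
  obtain n where k: "k = Suc n" using assms(2) by (cases k) auto
  have r: "0 \<le> ld_rem q p n" "ld_rem q p n < p" using ld_rem_bounds assms(1) by auto
  have "10 * ld_rem q p n div p * p \<le> 10 * ld_rem q p n"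
    using assms(1) by (simp add: minus_mod_eq_div_mult[symmetric])
  also have "\<dots> < 10 * p" using r by simp
  finally have "10 * ld_rem q p n div p < 10"
    using assms(1) mult_less_cancel_right_pos by blast
  then show ?thesis using k r assms(1) by (simp add: pos_imp_zdiv_nonneg_iff)
qed

lift_definition decimal_of_rat :: "rat \<Rightarrow> decimal" is
  "\<lambda>r. ld_digit (fst (quotient_of r)) (snd (quotient_of r))"
  using ld_digit_bounds quotient_of_denom_pos' by blast

lemma ld_scale:
  assumes "c > 0" "p > 0"
  shows "ld_rem (c * q) (c * p) k = c * ld_rem q p k"
    and "ld_digit (c * q) (c * p) k = ld_digit q p k"
proof -
  show rem: "ld_rem (c * q) (c * p) k = c * ld_rem q p k" for k
  proof (induction k)
    case 0 show ?case using assms by (simp add: algebra_simps)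
  next
    case (Suc k)
    have "10 * (c * ld_rem q p k) div (c * p) = 10 * ld_rem q p k div p"
      using assms by (metis div_mult_mult1 less_irrefl mult.left_commute)
    then show ?case by (simp add: Suc algebra_simps)
  qed
  show "ld_digit (c * q) (c * p) k = ld_digit q p k"
    using assms by (cases k) (simp_all add: rem mult.left_commute[of 10 c])
qed

text \<open>The digits do not depend on the fraction chosen to represent the rational.\<close>

lemma digit_decimal_of_rat_Fract:
  assumes "p > 0"
  shows "digit (decimal_of_rat (Fract q p)) k = ld_digit q p k"
proof -
  let ?g = "gcd q p"
  have g: "?g > 0" using assms by (simp add: gcd_pos_int)
  have "quotient_of (Fract q p) = (q div ?g, p div ?g)"
    using assms by (simp add: quotient_of_Fract Rat.normalize_def Let_def)
  moreover have "p div ?g > 0" using assms g by (simp add: pos_imp_zdiv_pos_iff zdvd_imp_le)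
  moreover have "?g * (q div ?g) = q" "?g * (p div ?g) = p" by simp_all
  ultimately show ?thesis
    using ld_scale(2)[OF g, of "p div ?g" "q div ?g" k] by (simp add: decimal_of_rat.rep_eq)
qed

text \<open>Sequences are indexed by the positive naturals; the value at \<open>0\<close> is ignored.\<close>

definition upper_LIMIT :: "(nat \<Rightarrow> decimal) \<Rightarrow> decimal" where
  "upper_LIMIT x = Inf {Sup {x k |k. k \<ge> n} |n. n \<ge> 1}"

definition lower_LIMIT :: "(nat \<Rightarrow> decimal) \<Rightarrow> decimal" where
  "lower_LIMIT x = Sup {Inf {x k |k. k \<ge> n} |n. n \<ge> 1}"

definition Cauchy_rat :: "(nat \<Rightarrow> rat) \<Rightarrow> bool" where
  "Cauchy_rat x \<longleftrightarrow> (\<forall>\<epsilon>>0. \<exists>N\<ge>1. \<forall>m\<ge>N. \<forall>n\<ge>N. \<bar>x m - x n\<bar> < \<epsilon>)"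

lemma Cauchy_rat_iff_cauchy: "Cauchy_rat x \<longleftrightarrow> Real.cauchy x"
proof -
  have "(\<exists>N\<ge>1. \<forall>m\<ge>N. \<forall>n\<ge>N. \<bar>x m - x n\<bar> < e) \<longleftrightarrow> (\<exists>N. \<forall>m\<ge>N. \<forall>n\<ge>N. \<bar>x m - x n\<bar> < e)" for e
    by (meson le_add1 le_add2 order_trans)
  then show ?thesis by (simp add: Cauchy_rat_def Real.cauchy_def)
qed

end

theory Submission
  imports Defs
begin

text \<open>If \<open>L \<prec> z \<prec> U\<close> for the lower and upper limits \<open>L\<close>, \<open>U\<close>, then at some length \<open>n\<close> the
  truncations of \<open>L\<close> and \<open>U\<close> differ by at least \<open>2 / 10 ^ n\<close>, one unit of the last place for each of
  the two strict inequalities. This leaves room for rationals \<open>a < b\<close> with \<open>L \<prec> a\<close> and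
  \<open>b \<prec> U\<close>, and the sequence is infinitely often below \<open>a\<close> and infinitely often above \<open>b\<close>.\<close>

lemma trunc_mono:
  assumes "y \<le> z" shows "trunc y k \<le> trunc z k"
  using assms lex_trunc_le less_decimal_iff_lex by (metis order_le_less order.refl)

lemma less_of_trunc_less: "trunc y k < trunc z k \<Longrightarrow> y < z"
  by (rule ccontr) (simp add: not_less leD[OF trunc_mono])

text \<open>From the first differing digit on, later digits can shrink the lead of \<open>z\<close>
  but never below one unit of the last place. Having this for all large \<open>n\<close> lets two
  gaps be compared at a common length.\<close>

lemma less_trunc_gap:
  assumes "y < z"
  obtains i where "\<And>n. n \<ge> i \<Longrightarrow> trunc y n + 1 / 10 ^ n \<le> trunc z n"
proof -
  obtain i where i: "\<forall>j<i. digit y j = digit z j" "digit y i < digit z i"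
    using assms unfolding less_decimal_iff_lex lex_less_def by blast
  have "trunc y n + 1 / 10 ^ n \<le> trunc z n" if "n \<ge> i" for n
    using trunc_gap[OF i, of "n - i"] that by simp
  then show ?thesis using that by blast
qed

text \<open>Invariant of long division: each step splits the scaled remainder into the next digit
  and the new remainder, as \<open>10 * ld_rem q p k = ld_digit q p (Suc k) * p + ld_rem q p (Suc
  k)\<close>.\<close>

lemma sum_ld_digit:
  assumes "p > 0"
  shows "(\<Sum>i\<le>k. of_int (ld_digit q p i) / 10 ^ i) + of_int (ld_rem q p k) / (of_int p * 10 ^ k)
    = (of_int q / of_int p :: rat)"
proof (induction k)
  case 0
  then show ?case using assms by (simp add: field_simps)
next
  case (Suc k)
  have "of_int (ld_digit q p (Suc k)) / 10 ^ Suc k + of_int (ld_rem q p (Suc k)) / (of_int p * 10 ^ Suc k)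
      = (of_int (ld_rem q p k) / (of_int p * 10 ^ k) :: rat)"
    using assms by (simp add: field_simps)
  then show ?case using Suc.IH by (simp only: sum.atMost_Suc add.assoc)
qed

text \<open>The remainder is at least \<open>0\<close> and less than \<open>p\<close>, which bounds
  the error term in \<open>sum_ld_digit\<close>. Strictness above reflects that long division never
  ends in repeated nines.\<close>

lemma trunc_decimal_of_rat:
  shows trunc_decimal_of_rat_le: "trunc (decimal_of_rat r) k \<le> r"
    and less_trunc_decimal_of_rat: "r < trunc (decimal_of_rat r) k + 1 / 10 ^ k"
proof -
  obtain q p where r: "r = Fract q p" and p: "p > 0" by (cases r) auto
  have t: "trunc (decimal_of_rat r) k = (\<Sum>i\<le>k. of_int (ld_digit q p i) / 10 ^ i)"
    by (simp add: trunc_def r digit_decimal_of_rat_Fract[OF p])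
  have eq: "trunc (decimal_of_rat r) k + of_int (ld_rem q p k) / (of_int p * 10 ^ k) = r"
    using sum_ld_digit[OF p, of q k] by (simp add: t) (simp add: r Fract_of_int_quotient)
  have "0 \<le> (of_int (ld_rem q p k) / (of_int p * 10 ^ k) :: rat)"
    "of_int (ld_rem q p k) / (of_int p * 10 ^ k) < (1 / 10 ^ k :: rat)"
    using ld_rem_bounds[OF p, of q k] p by (simp_all add: field_simps)
  then show "trunc (decimal_of_rat r) k \<le> r" "r < trunc (decimal_of_rat r) k + 1 / 10 ^ k"
    using eq by linarith+
qed

text \<open>Used in contrapositive form, to carry strict inequalities between decimals back to the
  rationals.\<close>

lemma decimal_of_rat_mono:
  assumes "r \<le> s" shows "decimal_of_rat r \<le> decimal_of_rat s"
proof (rule ccontr)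
  assume "\<not> decimal_of_rat r \<le> decimal_of_rat s"
  then obtain i where "trunc (decimal_of_rat s) i + 1 / 10 ^ i \<le> trunc (decimal_of_rat r) i"
    using less_trunc_gap by (metis not_le order.refl)
  then show False
    using trunc_decimal_of_rat_le[of r i] less_trunc_decimal_of_rat[of s i] assms by linarith
qed

lemma rats_between_decimals:
  assumes "y < z" "z < w"
  obtains a b where "a < b" "y < decimal_of_rat a" "decimal_of_rat b < w"
proof -
  obtain i where i: "\<And>n. n \<ge> i \<Longrightarrow> trunc y n + 1 / 10 ^ n \<le> trunc z n"
    using less_trunc_gap[OF assms(1)] by blast
  obtain j where j: "\<And>n. n \<ge> j \<Longrightarrow> trunc z n + 1 / 10 ^ n \<le> trunc w n"
    using less_trunc_gap[OF assms(2)] by blast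
  define n where "n = max i j"
  define d :: rat where "d = 1 / 10 ^ n"
  \<comment> \<open>The strict bound \<open>a < trunc (decimal_of_rat a) n + d\<close> then pushes
    the truncation of \<open>a\<close> above \<open>trunc y n\<close>.\<close>
  define a where "a = trunc y n + d"
  \<comment> \<open>Any value below \<open>trunc w n\<close> truncates below it. Since
    \<open>trunc w n\<close> is at least \<open>trunc y n + 2 * d\<close>, subtracting only
    \<open>d / 2\<close> keeps \<open>b - a\<close> at least \<open>d / 2\<close>.\<close>
  define b where "b = trunc w n - d / 2"
  have d: "d > 0" by (simp add: d_def)
  have gap: "trunc y n + d \<le> trunc z n" "trunc z n + d \<le> trunc w n"
    using i[of n] j[of n] by (simp_all add: n_def d_def)
  have "trunc y n < trunc (decimal_of_rat a) n"
    using less_trunc_decimal_of_rat[of a n] by (simp add: a_def d_def)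
  then have "y < decimal_of_rat a" by (rule less_of_trunc_less)
  moreover have "trunc (decimal_of_rat b) n < trunc w n"
    using trunc_decimal_of_rat_le[of b n] d by (simp add: b_def)
  then have "decimal_of_rat b < w" by (rule less_of_trunc_less)
  moreover have "a < b" using gap d by (simp add: a_def b_def)
  ultimately show ?thesis using that by blast
qed

context
  fixes x :: "nat \<Rightarrow> decimal" and l u :: decimal
  assumes bounds: "\<And>k. l \<le> x k" "\<And>k. x k \<le> u"
begin

lemma bdd_tail: "bdd_below {x k |k. k \<ge> n}" "bdd_above {x k |k. k \<ge> n}"
  using bounds by (auto intro: bdd_belowI[of _ l] bdd_aboveI[of _ u])

lemma Inf_tail_le: "m \<ge> n \<Longrightarrow> Inf {x k |k. k \<ge> n} \<le> x m"
  by (rule cInf_lower[OF _ bdd_tail(1)]) auto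

lemma le_Sup_tail: "m \<ge> n \<Longrightarrow> x m \<le> Sup {x k |k. k \<ge> n}"
  by (rule cSup_upper[OF _ bdd_tail(2)]) auto

lemma Inf_tail_le_lower_LIMIT: "n \<ge> 1 \<Longrightarrow> Inf {x k |k. k \<ge> n} \<le> lower_LIMIT x"
  unfolding lower_LIMIT_def
  by (rule cSup_upper)
    (auto intro!: bdd_aboveI[of _ u] order_trans[OF Inf_tail_le[OF order.refl] bounds(2)])

lemma upper_LIMIT_le_Sup_tail: "n \<ge> 1 \<Longrightarrow> upper_LIMIT x \<le> Sup {x k |k. k \<ge> n}"
  unfolding upper_LIMIT_def
  by (rule cInf_lower)
    (auto intro!: bdd_belowI[of _ l] order_trans[OF bounds(1) le_Sup_tail[OF order.refl]])

lemma lower_LIMIT_le_upper_LIMIT: "lower_LIMIT x \<le> upper_LIMIT x"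
proof -
  have "Inf {x k |k. k \<ge> m} \<le> Sup {x k |k. k \<ge> n}" for m n
    \<comment> \<open>The term at index \<open>max m n\<close> belongs to both tails.\<close>
    using Inf_tail_le[of m "max m n"] le_Sup_tail[of n "max m n"] by simp
  then show ?thesis unfolding lower_LIMIT_def upper_LIMIT_def
    by (intro cSup_least cInf_greatest) auto
qed

text \<open>Every tail infimum is at most the lower limit, so \<open>c\<close> is not a lower bound
  of any tail.\<close>

lemma lower_LIMIT_frequently_less:
  assumes "lower_LIMIT x < c" "n \<ge> 1"
  obtains k where "k \<ge> n" "x k < c"
proof -
  have "Inf {x k |k. k \<ge> n} < c"
    using Inf_tail_le_lower_LIMIT[OF assms(2)] assms(1) by simp
  then obtain v where "v \<in> {x k |k. k \<ge> n}" "v < c"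
    by (rule cInf_lessD[rotated, elim_format]) auto
  then show ?thesis using that by auto
qed

lemma upper_LIMIT_frequently_greater:
  assumes "c < upper_LIMIT x" "n \<ge> 1"
  obtains k where "k \<ge> n" "c < x k"
proof -
  have "c < Sup {x k |k. k \<ge> n}"
    using upper_LIMIT_le_Sup_tail[OF assms(2)] assms(1) by simp
  then obtain v where "v \<in> {x k |k. k \<ge> n}" "c < v"
    by (rule less_cSupD[rotated, elim_format]) auto
  then show ?thesis using that by auto
qed

end

theorem theorem7p2:
  fixes x :: "nat \<Rightarrow> rat"
  assumes "Cauchy_rat x"
  shows "no_gap (lower_LIMIT (\<lambda>n. decimal_of_rat (x n))) (upper_LIMIT (\<lambda>n. decimal_of_rat (x n)))"
proof -
  let ?y = "\<lambda>n. decimal_of_rat (x n)"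
  \<comment> \<open>Boundedness makes the suprema and infima of the tails meaningful.\<close>
  obtain B where B: "\<And>n. \<bar>x n\<bar> < B"
    using cauchy_imp_bounded[of x] assms by (auto simp: Cauchy_rat_iff_cauchy)
  have "- B \<le> x n" "x n \<le> B" for n using B[of n] by linarith+
  then have y: "decimal_of_rat (- B) \<le> ?y n" "?y n \<le> decimal_of_rat B" for n
    by (auto intro: decimal_of_rat_mono)
  have False if z: "lower_LIMIT ?y < z" "z < upper_LIMIT ?y" for z
  proof -
    obtain a b where ab: "a < b" "lower_LIMIT ?y < decimal_of_rat a" "decimal_of_rat b < upper_LIMIT ?y"
      using rats_between_decimals[OF z] .
    obtain N where N: "N \<ge> 1" "\<And>m n. m \<ge> N \<Longrightarrow> n \<ge> N \<Longrightarrow> \<bar>x m - x n\<bar> < b - a"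
      using assms[unfolded Cauchy_rat_def, rule_format, of "b - a"] ab(1) by auto
    obtain k where k: "k \<ge> N" "?y k < decimal_of_rat a"
      using lower_LIMIT_frequently_less[where x = ?y, OF y ab(2) N(1)] .
    obtain m where m: "m \<ge> N" "decimal_of_rat b < ?y m"
      using upper_LIMIT_frequently_greater[where x = ?y, OF y ab(3) N(1)] .
    have "x k < a" "b < x m"
      by (rule ccontr, use k(2) decimal_of_rat_mono[of a "x k"] in simp)
        (rule ccontr, use m(2) decimal_of_rat_mono[of "x m" b] in simp)
    \<comment> \<open>Here \<open>x m - x k\<close> exceeds \<open>b - a\<close>, although both
      indices are at least \<open>N\<close>.\<close>
    then show False using N(2)[OF m(1) k(1)] by linarith
  qed
  \<comment> \<open>This excludes the other case in \<open>no_gap\<close>, a point above the upper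
    and below the lower limit.\<close>
  moreover have "lower_LIMIT ?y \<le> upper_LIMIT ?y"
    by (rule lower_LIMIT_le_upper_LIMIT[where x = ?y, OF y])
  ultimately show ?thesis unfolding no_gap_def by (meson leD order.strict_trans)
qed

end
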